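(* Let $G$ be a finite graph, with transition probabilities $p(x,y)$ on $G$ reversible with respect to a probability measure $\nu$ on $G$, and with lamp-flip rates $c_x(\sigma)$ ($x\in G$, $\sigma\in\{0,1\}^G$) reversible with respect to a probability measure $\mu$ on $\{0,1\}^G$. Let $\pi=\mu\times\nu$. For $B\subset G$ let $\bar B:=\{x\in G:\exists\, y\in B \text{ such that } x\sim y\}$. Let $\varepsilon>0$ and assume that for every subset $B\subset G$, $$|\bar B|\ge \tfrac12|G| \ \Longrightarrow\ |B|\ge \varepsilon|G| .$$ Assume that $\mu$ and $\nu$ are the uniform measures on $\{0,1\}^G$ and $G$ respectively. Then $$C_{LS}(\pi)\ge \varepsilon\,\frac{|G|}{\mathrm{gap}(\nu)} .$$
   Context: Let $G=(V,E)$ be a finite graph; write $x\in G$ for $x\in V$, $|\cdot|$ for cardinality, and $x\sim y$ if $(x,y)\in E$. The lamplighter graph $G^\diamond=\{0,1\}\wr G$ has vertex set $\{0,1\}^G\times G$, whose elements are the pairs $(\sigma,x)$ (lamp configuration $\sigma$, lamplighter position $x$). For $\sigma\in\{0,1\}^G$ and $x\in G$, $\sigma^x$ denotes the configuration flipped at $x$: $\sigma^x(y)=\sigma(y)$ for $y\ne x$ and $\sigma^x(x)=1-\sigma(x)$. $p(x,y)$ denotes the transition probability for the lamplighter to move from $x$ to $y$ (along edges of $G$), and $c_x(\sigma)\ge 0$ the transition rate from $\sigma$ to $\sigma^x$. Reversibility with respect to the probability measures $\nu$ on $G$ and $\mu$ on $\{0,1\}^G$ means that, for all $x,y\in G$ and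 $\sigma\in\{0,1\}^G$, $$\nu(x)p(x,y)=\nu(y)p(y,x),\qquad \mu(\sigma)c_x(\sigma)=\mu(\sigma^x)c_x(\sigma^x).$$ The product measure is $\pi(\sigma,x)=\mu(\sigma)\nu(x)$ on $G^\diamond$. The Dirichlet form of $G^\diamond$ is, for $f:G^\diamond\to\mathbb{R}$, $$\mathcal{E}_\pi(f)=\frac14\sum_{\sigma}\sum_{x\in G}\pi(\sigma,x)\sum_{y\sim x}p(x,y)\,[f(\sigma,y)-f(\sigma,x)]^2+\frac14\sum_{\sigma}\sum_{x\in G}\pi(\sigma,x)\,c_x(\sigma)\,[f(\sigma^x,x)-f(\sigma,x)]^2 .$$ The logarithmic Sobolev constant $C_{LS}(\pi)$ is the best (smallest) constant $C$ such that for every $f:G^\diamond\to\mathbb{R}$, $\mathbf{Ent}_\pi(f^2)\le C\,\mathcal{E}_\pi(f)$, where $\mathbf{Ent}_\pi(f^2)=\pi\big(f^2\log(f^2/\pi(f^2))\big)$ and $\pi(g)$ is the mean of $g$ under $\pi$. The spectral gap $\mathrm{gap}(\nu)$ is the best (largest) constant $C$ such that for every $f:G\to\mathbb{R}$, $C\,\mathbf{Var}_\nu(f)\le\mathcal{E}_\nu(f)$, where $\mathbf{Var}_\nu(f)=\nu(f^2)-\nu(f)^2$, $\nu(g)=\sum_{x\in G}\nu(x)g(x)$ and $$\mathcal{E}_\nu(f)=\frac12\sum_{x\in G}\sum_{y\sim x}\nu(x)p(x,y)[f(y)-f(x)]^2 .$$ *)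

theory Defs
  imports "HOL-Probability.Probability"
begin

text \<open>
  The vertex set of the graph \<open>G\<close> is a finite type \<open>'a\<close>, so \<open>|G|\<close> is \<open>CARD('a)\<close>; the edge set
  \<open>E\<close> is a symmetric relation, in which loops are allowed. A lamp configuration is a function
  \<open>'a \<Rightarrow> bool\<close>, and a vertex of the lamplighter graph a pair \<open>(\<sigma>, x)\<close>.
\<close>

type_synonym 'a config = "'a \<Rightarrow> bool"

definition flip :: "'a config \<Rightarrow> 'a \<Rightarrow> 'a config" where
  "flip \<sigma> x = \<sigma>(x := \<not> \<sigma> x)"

text \<open>
  A positive holding probability \<open>p x x\<close> does not require a loop at \<open>x\<close>; it never contributes to a
  Dirichlet form.
\<close>

definition transition_probabilities :: "('a::finite \<times> 'a) set \<Rightarrow> ('a \<Rightarrow> 'a \<Rightarrow> real) \<Rightarrow> bool" where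
  "transition_probabilities E p \<longleftrightarrow>
     (\<forall>x y. 0 \<le> p x y) \<and> (\<forall>x. (\<Sum>y\<in>UNIV. p x y) = 1) \<and>
     (\<forall>x y. x \<noteq> y \<longrightarrow> (x, y) \<notin> E \<longrightarrow> p x y = 0)"

definition reversible_walk :: "'a pmf \<Rightarrow> ('a \<Rightarrow> 'a \<Rightarrow> real) \<Rightarrow> bool" where
  "reversible_walk \<nu> p \<longleftrightarrow> (\<forall>x y. pmf \<nu> x * p x y = pmf \<nu> y * p y x)"

definition reversible_lamps :: "'a config pmf \<Rightarrow> ('a \<Rightarrow> 'a config \<Rightarrow> real) \<Rightarrow> bool" where
  "reversible_lamps \<mu> c \<longleftrightarrow>
     (\<forall>x \<sigma>. pmf \<mu> \<sigma> * c x \<sigma> = pmf \<mu> (flip \<sigma> x) * c x (flip \<sigma> x))"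

definition nbhd :: "('a \<times> 'a) set \<Rightarrow> 'a set \<Rightarrow> 'a set" where
  "nbhd E B = {x. \<exists>y\<in>B. (x, y) \<in> E}"

definition Var :: "'b pmf \<Rightarrow> ('b \<Rightarrow> real) \<Rightarrow> real" where
  "Var \<rho> f = measure_pmf.expectation \<rho> (\<lambda>z. (f z)\<^sup>2) - (measure_pmf.expectation \<rho> f)\<^sup>2"

text \<open>
  \<open>Ent \<rho> g\<close> is used for \<open>g = f\<^sup>2 \<ge> 0\<close>; the conventions \<open>ln 0 = 0\<close> and \<open>0 / 0 = 0\<close> give the usual
  value \<open>0\<close> for \<open>0 log 0\<close> and for the entropy of the zero function.
\<close>

definition Ent :: "'b pmf \<Rightarrow> ('b \<Rightarrow> real) \<Rightarrow> real" where
  "Ent \<rho> g = measure_pmf.expectation \<rho> (\<lambda>z. g z * ln (g z / measure_pmf.expectation \<rho> g))"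

definition dirichlet_walk ::
    "('a::finite \<times> 'a) set \<Rightarrow> ('a \<Rightarrow> 'a \<Rightarrow> real) \<Rightarrow> 'a pmf \<Rightarrow> ('a \<Rightarrow> real) \<Rightarrow> real" where
  "dirichlet_walk E p \<nu> f =
     1/2 * (\<Sum>x\<in>UNIV. \<Sum>y | (x, y) \<in> E. pmf \<nu> x * p x y * (f y - f x)\<^sup>2)"

definition dirichlet_lamplighter ::
    "('a::finite \<times> 'a) set \<Rightarrow> ('a \<Rightarrow> 'a \<Rightarrow> real) \<Rightarrow> ('a \<Rightarrow> 'a config \<Rightarrow> real) \<Rightarrow>
     ('a config \<times> 'a) pmf \<Rightarrow> ('a config \<times> 'a \<Rightarrow> real) \<Rightarrow> real" where
  "dirichlet_lamplighter E p c \<pi> f =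
     1/4 * (\<Sum>\<sigma>\<in>UNIV. \<Sum>x\<in>UNIV. pmf \<pi> (\<sigma>, x) *
              (\<Sum>y | (x, y) \<in> E. p x y * (f (\<sigma>, y) - f (\<sigma>, x))\<^sup>2)) +
     1/4 * (\<Sum>\<sigma>\<in>UNIV. \<Sum>x\<in>UNIV. pmf \<pi> (\<sigma>, x) *
              c x \<sigma> * (f (flip \<sigma> x, x) - f (\<sigma>, x))\<^sup>2)"

text \<open>
  The best constants are extended reals: \<open>spectral_gap\<close> is \<open>\<infinity>\<close> when the variance vanishes identically (as on
  a one-point graph), and \<open>log_sobolev_const\<close> is \<open>\<infinity>\<close> when no finite constant works. In type \<open>ereal\<close>, \<open>r / 0 = \<infinity>\<close> for
  \<open>r > 0\<close> and \<open>r / \<infinity> = 0\<close>.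
\<close>

definition spectral_gap ::
    "('a::finite \<times> 'a) set \<Rightarrow> ('a \<Rightarrow> 'a \<Rightarrow> real) \<Rightarrow> 'a pmf \<Rightarrow> ereal" where
  "spectral_gap E p \<nu> = Sup {ereal C | C. \<forall>f. C * Var \<nu> f \<le> dirichlet_walk E p \<nu> f}"

definition log_sobolev_const ::
    "('a::finite \<times> 'a) set \<Rightarrow> ('a \<Rightarrow> 'a \<Rightarrow> real) \<Rightarrow> ('a \<Rightarrow> 'a config \<Rightarrow> real) \<Rightarrow>
     ('a config \<times> 'a) pmf \<Rightarrow> ereal" where
  "log_sobolev_const E p c \<pi> =
     Inf {ereal C | C. \<forall>f. Ent \<pi> (\<lambda>z. (f z)\<^sup>2) \<le> C * dirichlet_lamplighter E p c \<pi> f}"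

end

theory Submission
  imports Defs
begin

text \<open>
  For \<open>B \<subseteq> G\<close> and a function \<open>g\<close> on \<open>G\<close> vanishing on \<open>B\<close>, test the logarithmic Sobolev inequality on
  \<open>f (\<sigma>, x) = 1{\<sigma> = 0 on B} g x\<close>. The support condition kills the lamp part of the Dirichlet form,
  whereas the constraint on the lamps contributes \<open>|B| log 2\<close> to the entropy, so
  \<open>C \<ge> 2 log 2 |B| \<nu>(g\<^sup>2) / \<E>\<^sub>\<nu>(g)\<close>. Splitting a near-optimal function for the spectral gap into its
  positive and negative parts around a median yields such a \<open>g\<close> with Rayleigh quotient close to
  \<open>gap(\<nu>)\<close> that vanishes on at least half of \<open>G\<close>. If the gap is positive, every vertex has a
  neighbour, so the zero set of \<open>g\<close> is covered by the neighbourhood of a set that is no larger,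
  and therefore has at least \<open>\<epsilon> |G|\<close> elements.
\<close>

section \<open>Entropy of an indicator times a function under a product measure\<close>

lemma expectation_finite:
  fixes \<rho> :: "'b::finite pmf" and f :: "'b \<Rightarrow> real"
  shows "measure_pmf.expectation \<rho> f = (\<Sum>z\<in>UNIV. pmf \<rho> z * f z)"
  by (subst integral_measure_pmf_real[of UNIV]) (auto simp: mult.commute)

lemma sum_pair_pmf:
  fixes \<mu> :: "'b::finite pmf" and \<nu> :: "'c::finite pmf" and u v :: "_ \<Rightarrow> real"
  shows "(\<Sum>z\<in>UNIV. pmf (pair_pmf \<mu> \<nu>) z * (u (fst z) * v (snd z)))
       = (\<Sum>\<sigma>\<in>UNIV. pmf \<mu> \<sigma> * u \<sigma>) * (\<Sum>x\<in>UNIV. pmf \<nu> x * v x)"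
  unfolding UNIV_Times_UNIV[symmetric] sum_product sum.cartesian_product
  by (rule sum.cong) (auto simp: pmf_pair)

text \<open>This is \<open>ln s \<le> s - 1\<close> at \<open>s = m / t\<close>. When
  \<open>t\<close> is averaged to \<open>m\<close>, the terms \<open>t - m\<close> cancel and only
  \<open>- m * ln a\<close> survives, which replaces an appeal to Jensen's inequality. At
  \<open>t = 0\<close> the convention \<open>0 * ln 0 = 0\<close> is used.\<close>

lemma mult_ln_div_ge:
  fixes t a m :: real
  assumes "t \<ge> 0" "a > 0" "m > 0"
  shows "t * ln (t / (a * m)) \<ge> t - m - t * ln a"
proof (cases "t = 0")
  case False
  then have t: "t > 0" using assms by simp
  have "ln (m / t) \<le> m / t - 1" using t assms by (intro ln_le_minus_one) simp
  then have "t * ln (m / t) \<le> m - t" using t by (simp add: field_simps)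
  moreover have "ln (t / (a * m)) = - ln (m / t) - ln a"
    using t assms by (simp add: ln_div ln_mult)
  ultimately show ?thesis by (simp only: right_diff_distrib)
qed (use assms in simp)

text \<open>Entropy of a product splits into a contribution of the indicator, which is the bound
  stated, and \<open>prob A\<close> times the entropy of \<open>g\<^sup>2\<close> under \<nu>, which
  is nonnegative and is discarded.\<close>

lemma Ent_indicator_product_ge:
  fixes \<mu> :: "'b::finite pmf" and \<nu> :: "'c::finite pmf" and g :: "'c \<Rightarrow> real"
  assumes a: "measure_pmf.prob \<mu> A > 0"
    and m: "measure_pmf.expectation \<nu> (\<lambda>x. (g x)\<^sup>2) > 0"
  shows "Ent (pair_pmf \<mu> \<nu>) (\<lambda>z. (of_bool (fst z \<in> A) * g (snd z))\<^sup>2)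
     \<ge> - (measure_pmf.prob \<mu> A * ln (measure_pmf.prob \<mu> A)
           * measure_pmf.expectation \<nu> (\<lambda>x. (g x)\<^sup>2))"
proof -
  define a where "a = measure_pmf.prob \<mu> A"
  define m where "m = measure_pmf.expectation \<nu> (\<lambda>x. (g x)\<^sup>2)"
  have a_sum: "a = (\<Sum>\<sigma>\<in>UNIV. pmf \<mu> \<sigma> * of_bool (\<sigma> \<in> A))"
    unfolding a_def by (simp add: measure_measure_pmf_finite if_distrib sum.If_cases of_bool_def
        flip: sum.inter_filter)
  have m_sum: "m = (\<Sum>x\<in>UNIV. pmf \<nu> x * (g x)\<^sup>2)"
    unfolding m_def expectation_finite ..
  have one: "(\<Sum>x\<in>UNIV. pmf \<nu> x) = 1" by (rule sum_pmf_eq_1) auto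
  have sq: "(of_bool P * t)\<^sup>2 = of_bool P * t\<^sup>2" for P and t :: real
    by simp
  have mean: "measure_pmf.expectation (pair_pmf \<mu> \<nu>)
      (\<lambda>z. (of_bool (fst z \<in> A) * g (snd z))\<^sup>2) = a * m"
    unfolding expectation_finite sq
    using sum_pair_pmf[of \<mu> \<nu> "\<lambda>\<sigma>. of_bool (\<sigma> \<in> A)" "\<lambda>x. (g x)\<^sup>2"] a_sum m_sum by simp
  have "(\<Sum>z\<in>UNIV. pmf (pair_pmf \<mu> \<nu>) z *
        (of_bool (fst z \<in> A) * ((g (snd z))\<^sup>2 - m - (g (snd z))\<^sup>2 * ln a)))
     = a * (\<Sum>x\<in>UNIV. pmf \<nu> x * ((g x)\<^sup>2 - m - (g x)\<^sup>2 * ln a))"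
    using sum_pair_pmf[of \<mu> \<nu> "\<lambda>\<sigma>. of_bool (\<sigma> \<in> A)" "\<lambda>x. (g x)\<^sup>2 - m - (g x)\<^sup>2 * ln a"] a_sum by simp
  also have "(\<Sum>x\<in>UNIV. pmf \<nu> x * ((g x)\<^sup>2 - m - (g x)\<^sup>2 * ln a)) = m - 1 * m - m * ln a"
  proof -
    have "pmf \<nu> x * ((g x)\<^sup>2 - m - (g x)\<^sup>2 * ln a)
        = pmf \<nu> x * (g x)\<^sup>2 - pmf \<nu> x * m - (pmf \<nu> x * (g x)\<^sup>2) * ln a" for x
      by (simp add: algebra_simps)
    then show ?thesis
      by (simp only: sum_subtractf flip: sum_distrib_right) (simp only: one m_sum)
  qed
  finally have "- (a * ln a * m) = (\<Sum>z\<in>UNIV. pmf (pair_pmf \<mu> \<nu>) z *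
        (of_bool (fst z \<in> A) * ((g (snd z))\<^sup>2 - m - (g (snd z))\<^sup>2 * ln a)))"
    by simp
  \<comment> \<open>Pointwise comparison: off \<open>A\<close> both sides are 0, and on
    \<open>A\<close> it is \<open>mult_ln_div_ge\<close> with
    \<open>t = (g x)\<^sup>2\<close>.\<close>
  also have "\<dots> \<le> (\<Sum>z\<in>UNIV. pmf (pair_pmf \<mu> \<nu>) z *
        ((of_bool (fst z \<in> A) * g (snd z))\<^sup>2 * ln ((of_bool (fst z \<in> A) * g (snd z))\<^sup>2 / (a * m))))"
    using mult_ln_div_ge[OF _ a m, folded a_def m_def]
    by (intro sum_mono mult_left_mono) auto
  also have "\<dots> = Ent (pair_pmf \<mu> \<nu>) (\<lambda>z. (of_bool (fst z \<in> A) * g (snd z))\<^sup>2)"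
    unfolding Ent_def mean by (simp only: expectation_finite)
  finally show ?thesis unfolding a_def m_def .
qed

section \<open>Test functions requiring all lamps on a set to be off\<close>

lemma card_configs_off:
  fixes B :: "'a::finite set"
  shows "card {\<sigma> :: 'a config. \<forall>x\<in>B. \<not> \<sigma> x} = 2 ^ (CARD('a) - card B)"
proof -
  \<comment> \<open>\<open>Collect\<close> sends a configuration to its set of lit lamps.\<close>
  have "bij_betw Collect {\<sigma> :: 'a config. \<forall>x\<in>B. \<not> \<sigma> x} (Pow (- B))"
    by (rule bij_betwI[where g = "\<lambda>S x. x \<in> S"]) auto
  then show ?thesis
    by (simp add: bij_betw_same_card card_Pow Compl_eq_Diff_UNIV card_Diff_subset)
qed

lemma prob_configs_off:
  fixes B :: "'a::finite set"
  shows "measure_pmf.prob (pmf_of_set (UNIV :: 'a config set)) {\<sigma>. \<forall>x\<in>B. \<not> \<sigma> x} = 1 / 2 ^ card B"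
proof -
  have "card B \<le> CARD('a)" by (simp add: card_mono)
  then have "(2::real) ^ CARD('a) = 2 ^ (CARD('a) - card B) * 2 ^ card B"
    by (simp flip: power_add)
  moreover have "card (UNIV :: 'a config set) = 2 ^ CARD('a)"
    using card_configs_off[of "{} :: 'a set"] by simp
  ultimately show ?thesis
    by (simp add: measure_pmf_of_set card_configs_off)
qed

text \<open>A flip at \<open>x\<close> changes membership in \<open>A\<close> only if
  \<open>x \<in> B\<close>, and there \<open>g x = 0\<close>, so every lamp increment is 0. The
  factor 1/2 comes from the weights 1/4 and 1/2 in the two Dirichlet forms.\<close>

lemma dirichlet_lamplighter_indicator_product:
  fixes g :: "'a::finite \<Rightarrow> real"
  assumes g: "\<And>x. x \<in> B \<Longrightarrow> g x = 0"
  defines "A \<equiv> {\<sigma> :: 'a config. \<forall>x\<in>B. \<not> \<sigma> x}"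
  shows "dirichlet_lamplighter E p c (pair_pmf \<mu> \<nu>) (\<lambda>z. of_bool (fst z \<in> A) * g (snd z))
       = measure_pmf.prob \<mu> A * dirichlet_walk E p \<nu> g / 2"
proof -
  have lamps: "of_bool (flip \<sigma> x \<in> A) * g x - of_bool (\<sigma> \<in> A) * g x = 0" for \<sigma> x
  proof (cases "x \<in> B")
    case False
    then have "flip \<sigma> x \<in> A \<longleftrightarrow> \<sigma> \<in> A" by (auto simp: A_def flip_def)
    then show ?thesis by simp
  qed (simp add: g)
  have a_sum: "measure_pmf.prob \<mu> A = (\<Sum>\<sigma>\<in>UNIV. pmf \<mu> \<sigma> * of_bool (\<sigma> \<in> A))"
    by (simp add: measure_measure_pmf_finite if_distrib sum.If_cases of_bool_def
        flip: sum.inter_filter)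
  have walk: "p x y * (of_bool P * g y - of_bool P * g x)\<^sup>2 = of_bool P * (p x y * (g y - g x)\<^sup>2)"
    for P x y by simp
  have "dirichlet_lamplighter E p c (pair_pmf \<mu> \<nu>) (\<lambda>z. of_bool (fst z \<in> A) * g (snd z))
     = 1/4 * (\<Sum>\<sigma>\<in>UNIV. \<Sum>x\<in>UNIV. (pmf \<mu> \<sigma> * of_bool (\<sigma> \<in> A)) *
         (\<Sum>y | (x, y) \<in> E. pmf \<nu> x * p x y * (g y - g x)\<^sup>2))"
    unfolding dirichlet_lamplighter_def
    by (simp only: fst_conv snd_conv lamps walk pmf_pair)
       (simp add: sum_distrib_left mult_ac)
  also have "\<dots> = measure_pmf.prob \<mu> A * dirichlet_walk E p \<nu> g / 2"
    unfolding dirichlet_walk_def a_sum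
    by (subst sum_product[symmetric]) simp
  finally show ?thesis .
qed

text \<open>With \<open>a = 2^(- |B|)\<close>, the entropy is at least
  \<open>a * |B| * ln 2 * m\<close> and the energy is \<open>a\<close> times half the walk energy.
  The factor \<open>a\<close> cancels, and \<open>2 * ln 2 \<ge> 1\<close> removes the remaining
  constant.\<close>

lemma log_sobolev_test:
  fixes g :: "'a::finite \<Rightarrow> real"
  assumes C: "\<And>f. Ent (pair_pmf (pmf_of_set UNIV) \<nu>) (\<lambda>z. (f z)\<^sup>2)
      \<le> C * dirichlet_lamplighter E p c (pair_pmf (pmf_of_set UNIV) \<nu>) f"
    and g: "\<And>x. x \<in> B \<Longrightarrow> g x = 0"
    and m: "measure_pmf.expectation \<nu> (\<lambda>x. (g x)\<^sup>2) > 0"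
  shows "real (card B) * measure_pmf.expectation \<nu> (\<lambda>x. (g x)\<^sup>2) \<le> C * dirichlet_walk E p \<nu> g"
proof -
  define A where "A = {\<sigma> :: 'a config. \<forall>x\<in>B. \<not> \<sigma> x}"
  define a where "a = measure_pmf.prob (pmf_of_set UNIV) A"
  define m where "m = measure_pmf.expectation \<nu> (\<lambda>x. (g x)\<^sup>2)"
  have a: "a = 1 / 2 ^ card B" unfolding a_def A_def by (rule prob_configs_off)
  then have a0: "a > 0" by simp
  have "ln (1 / 2) \<le> 1 / 2 - (1::real)" by (intro ln_le_minus_one) simp
  then have ln2: "2 * ln 2 \<ge> (1::real)" by (simp add: ln_div)
  have lna: "- ln a = real (card B) * ln 2" unfolding a by (simp add: ln_div ln_realpow)
  have "a * (- ln a * m) \<le> Ent (pair_pmf (pmf_of_set UNIV) \<nu>) (\<lambda>z. (of_bool (fst z \<in> A) * g (snd z))\<^sup>2)"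
    using Ent_indicator_product_ge[of "pmf_of_set UNIV" A \<nu> g] a0 m
    unfolding a_def m_def by (simp add: mult_ac)
  also have "\<dots> \<le> C * (a * dirichlet_walk E p \<nu> g / 2)"
    using C[of "\<lambda>z. of_bool (fst z \<in> A) * g (snd z)"]
      dirichlet_lamplighter_indicator_product[of B g E p c "pmf_of_set UNIV" \<nu>] g
    by (simp only: a_def A_def)
  also have "\<dots> = a * (C * dirichlet_walk E p \<nu> g / 2)" by simp
  finally have "- ln a * m \<le> C * dirichlet_walk E p \<nu> g / 2"
    using a0 by (simp only: mult_le_cancel_left_pos)
  then have "(2 * ln 2) * (real (card B) * m) \<le> C * dirichlet_walk E p \<nu> g"
    unfolding lna by (simp add: algebra_simps)
  moreover have "1 * (real (card B) * m) \<le> (2 * ln 2) * (real (card B) * m)"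
    using ln2 m by (intro mult_right_mono) (auto simp: m_def)
  ultimately show ?thesis unfolding m_def by simp
qed

text \<open>A single function of positive entropy suffices, because the Dirichlet form is
  nonnegative. The sign is needed later to multiply energy bounds by \<open>C\<close>.\<close>

lemma log_sobolev_const_nonneg:
  fixes E :: "('a::finite \<times> 'a) set"
  assumes C: "\<And>f. Ent (pair_pmf (pmf_of_set UNIV) \<nu>) (\<lambda>z. (f z)\<^sup>2)
      \<le> C * dirichlet_lamplighter E p c (pair_pmf (pmf_of_set UNIV) \<nu>) f"
    and p: "\<And>x y. p x y \<ge> 0" and c: "\<And>x \<sigma>. c x \<sigma> \<ge> 0"
  shows "C \<ge> 0"
proof -
  define A where "A = {\<sigma> :: 'a config. \<forall>x. \<not> \<sigma> x}"
  define a where "a = measure_pmf.prob (pmf_of_set UNIV) A"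
  have a: "a = 1 / 2 ^ CARD('a)"
    unfolding a_def A_def using prob_configs_off[of "UNIV :: 'a set"] by simp
  \<comment> \<open>The indicator of the all-off configuration is not constant:
    \<open>CARD('a) \<ge> 1\<close> gives \<open>a < 1\<close>.\<close>
  then have "0 < - ln a" by (simp add: ln_div ln_realpow)
  then have "0 < a * - ln a" using a by (intro mult_pos_pos) auto
  also have "\<dots> \<le> Ent (pair_pmf (pmf_of_set UNIV) \<nu>) (\<lambda>z. (of_bool (fst z \<in> A) * (\<lambda>_. 1) (snd z))\<^sup>2)"
    using Ent_indicator_product_ge[of "pmf_of_set UNIV" A \<nu> "\<lambda>_. 1"] a
    unfolding a_def by simp
  also have "\<dots> \<le> C * dirichlet_lamplighter E p c (pair_pmf (pmf_of_set UNIV) \<nu>)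
      (\<lambda>z. of_bool (fst z \<in> A) * (\<lambda>_. 1) (snd z))" by (rule C)
  finally have "0 < C * dirichlet_lamplighter E p c (pair_pmf (pmf_of_set UNIV) \<nu>)
      (\<lambda>z. of_bool (fst z \<in> A) * (\<lambda>_. 1) (snd z))" .
  moreover have "dirichlet_lamplighter E p c \<pi> f \<ge> 0" for \<pi> f
    unfolding dirichlet_lamplighter_def
    by (intro add_nonneg_nonneg mult_nonneg_nonneg sum_nonneg) (auto simp: p c)
  ultimately show ?thesis by (metis linorder_not_le mult_nonpos_nonneg less_imp_le)
qed

section \<open>Splitting at a median and Rayleigh quotients\<close>

lemma median_exists:
  fixes f :: "'a::finite \<Rightarrow> real"
  obtains m where "CARD('a) \<le> 2 * card {x. f x \<le> m}" "CARD('a) \<le> 2 * card {x. f x \<ge> m}"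
proof -
  \<comment> \<open>The median is the least attained value with at least half of the points at or
    below it. The next smaller attained value fails this test, so fewer than half of the points lie
    strictly below the median.\<close>
  define V where "V = {v \<in> range f. CARD('a) \<le> 2 * card {x. f x \<le> v}}"
  have "{x. f x \<le> Max (range f)} = UNIV" by auto
  then have "CARD('a) \<le> 2 * card {x. f x \<le> Max (range f)}" by (simp only:)
  moreover have "Max (range f) \<in> range f" by (rule Max_in) auto
  ultimately have "Max (range f) \<in> V" unfolding V_def by blast
  moreover have "finite V" unfolding V_def by simp
  ultimately have V: "finite V" "V \<noteq> {}" by auto
  define m where "m = Min V"
  have "m \<in> V" unfolding m_def using V by (rule Min_in)
  have "CARD('a) \<le> 2 * card {x. f x \<ge> m}"
  proof (cases "{x. f x < m} = {}")
    case True
    then have "{x. f x \<ge> m} = UNIV" by (auto simp: not_less)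
    then show ?thesis by simp
  next
    case False
    define v where "v = Max (f ` {x. f x < m})"
    have "v \<in> f ` {x. f x < m}" unfolding v_def using False by (intro Max_in) auto
    then have v: "v < m" "v \<in> range f" by auto
    have "f x \<le> v" if "f x < m" for x unfolding v_def using that by (intro Max_ge) auto
    then have eq: "{x. f x \<le> v} = {x. f x < m}" using v by force
    have "v \<notin> V" using v V Min_le[of V v] unfolding m_def by auto
    then have less: "2 * card {x. f x < m} < CARD('a)" using v eq by (auto simp: V_def)
    have "{x. f x < m} \<union> {x. f x \<ge> m} = UNIV" by auto
    then have "CARD('a) \<le> card {x. f x < m} + card {x. f x \<ge> m}"
      by (metis card_Un_le)
    then show ?thesis using less by simp
  qed
  then show ?thesis using that[of m] \<open>m \<in> V\<close> by (auto simp: V_def)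
qed

text \<open>The positive part is nondecreasing and the negative part nonincreasing, so their
  increments have product at most 0 and the cross term in the square of the difference has a
  favourable sign.\<close>

lemma pos_neg_part_diff_le:
  fixes a b :: real
  shows "(max a 0 - max b 0)\<^sup>2 + (max (- a) 0 - max (- b) 0)\<^sup>2 \<le> (a - b)\<^sup>2"
proof -
  have "a - b = (max a 0 - max b 0) - (max (- a) 0 - max (- b) 0)" by (auto simp: max_def)
  moreover have "(max a 0 - max b 0) * (max (- a) 0 - max (- b) 0) \<le> 0"
    by (auto simp: mult_le_0_iff)
  ultimately show ?thesis by (simp only: power2_diff)
qed

lemma Var_le_second_moment:
  fixes \<rho> :: "'b::finite pmf"
  shows "Var \<rho> f \<le> measure_pmf.expectation \<rho> (\<lambda>z. (f z - m)\<^sup>2)"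
proof -
  have one: "(\<Sum>x\<in>UNIV. pmf \<rho> x) = 1" by (rule sum_pmf_eq_1) auto
  have "measure_pmf.expectation \<rho> (\<lambda>z. (f z - m)\<^sup>2)
      = measure_pmf.expectation \<rho> (\<lambda>z. (f z)\<^sup>2) - 2 * m * measure_pmf.expectation \<rho> f
        + m\<^sup>2 * (\<Sum>x\<in>UNIV. pmf \<rho> x)"
    unfolding expectation_finite sum_distrib_left sum_subtractf[symmetric] sum.distrib[symmetric]
    by (rule sum.cong) (auto simp: power2_eq_square algebra_simps)
  also have "\<dots> = Var \<rho> f + (measure_pmf.expectation \<rho> f - m)\<^sup>2"
    unfolding Var_def one by (simp add: power2_eq_square algebra_simps)
  finally show ?thesis by simp
qed

lemma dirichlet_walk_nonneg:
  assumes "\<And>x y. p x y \<ge> 0"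
  shows "dirichlet_walk E p \<nu> f \<ge> 0"
  unfolding dirichlet_walk_def using assms by (intro mult_nonneg_nonneg sum_nonneg) auto

text \<open>Energies of the positive and negative parts of \<open>f - m\<close> add up to at most
  that of \<open>f\<close>, while their second moments add up to at least
  \<open>Var \<nu> f\<close>; hence one part inherits the strict inequality. A strict inequality for
  some \<open>l\<close> avoids having to produce a minimizer for the gap.\<close>

lemma half_vanishing_test_function:
  fixes f :: "'a::finite \<Rightarrow> real"
  assumes p: "\<And>x y. p x y \<ge> 0"
    and f: "dirichlet_walk E p \<nu> f < l * Var \<nu> f" and l: "l > 0"
  obtains g where "CARD('a) \<le> 2 * card {x. g x = 0}"
    "dirichlet_walk E p \<nu> g < l * measure_pmf.expectation \<nu> (\<lambda>x. (g x)\<^sup>2)"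
proof -
  obtain m where m: "CARD('a) \<le> 2 * card {x. f x \<le> m}" "CARD('a) \<le> 2 * card {x. f x \<ge> m}"
    by (rule median_exists)
  define g where "g x = max (f x - m) 0" for x
  define h where "h x = max (- (f x - m)) 0" for x
  have zero: "{x. g x = 0} = {x. f x \<le> m}" "{x. h x = 0} = {x. f x \<ge> m}"
    unfolding g_def h_def by (auto simp: max_def)
  have "dirichlet_walk E p \<nu> g + dirichlet_walk E p \<nu> h
      = 1/2 * (\<Sum>x\<in>UNIV. \<Sum>y | (x, y) \<in> E. pmf \<nu> x * p x y * ((g y - g x)\<^sup>2 + (h y - h x)\<^sup>2))"
    unfolding dirichlet_walk_def distrib_left sum.distrib ..
  also have "\<dots> \<le> dirichlet_walk E p \<nu> f"
    unfolding dirichlet_walk_def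
  proof (intro mult_left_mono sum_mono)
    fix x y
    show "(g y - g x)\<^sup>2 + (h y - h x)\<^sup>2 \<le> (f y - f x)\<^sup>2"
      using pos_neg_part_diff_le[of "f y - m" "f x - m"] unfolding g_def h_def by simp
  qed (auto simp: p)
  also have "\<dots> < l * Var \<nu> f" by (rule f)
  also have "\<dots> \<le> l * measure_pmf.expectation \<nu> (\<lambda>z. (f z - m)\<^sup>2)"
    using l by (intro mult_left_mono Var_le_second_moment) auto
  \<comment> \<open>At each point one of \<open>g\<close> and \<open>h\<close> is 0, so the squares
    add without a cross term.\<close>
  also have "(\<lambda>z. (f z - m)\<^sup>2) = (\<lambda>z. (g z)\<^sup>2 + (h z)\<^sup>2)"
    unfolding g_def h_def by (auto simp: max_def power2_eq_square algebra_simps)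
  also have "measure_pmf.expectation \<nu> \<dots>
      = measure_pmf.expectation \<nu> (\<lambda>z. (g z)\<^sup>2) + measure_pmf.expectation \<nu> (\<lambda>z. (h z)\<^sup>2)"
    unfolding expectation_finite distrib_left sum.distrib ..
  finally have "dirichlet_walk E p \<nu> g < l * measure_pmf.expectation \<nu> (\<lambda>x. (g x)\<^sup>2)
      \<or> dirichlet_walk E p \<nu> h < l * measure_pmf.expectation \<nu> (\<lambda>x. (h x)\<^sup>2)"
    by (auto simp: distrib_left)
  then show ?thesis using that m zero by metis
qed

lemma log_sobolev_times_gap_ge:
  fixes E :: "('a::finite \<times> 'a) set"
  assumes C: "\<And>f. Ent (pair_pmf (pmf_of_set UNIV) \<nu>) (\<lambda>z. (f z)\<^sup>2)
      \<le> C * dirichlet_lamplighter E p c (pair_pmf (pmf_of_set UNIV) \<nu>) f"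
    and "C \<ge> 0" and p: "\<And>x y. p x y \<ge> 0"
    and f: "dirichlet_walk E p \<nu> f < l * Var \<nu> f" and l: "l > 0"
  obtains B :: "'a set" where "CARD('a) \<le> 2 * card B" "real (card B) \<le> C * l"
proof -
  obtain g where g: "CARD('a) \<le> 2 * card {x. g x = 0}"
    "dirichlet_walk E p \<nu> g < l * measure_pmf.expectation \<nu> (\<lambda>x. (g x)\<^sup>2)"
    using half_vanishing_test_function[OF p f l] by blast
  let ?m = "measure_pmf.expectation \<nu> (\<lambda>x. (g x)\<^sup>2)"
  \<comment> \<open>The strict inequality forces a positive second moment, as the test inequality
    requires.\<close>
  have "0 < l * ?m" using g(2) dirichlet_walk_nonneg[of p E \<nu> g, OF p] by linarith
  then have m: "?m > 0" using l by (simp add: zero_less_mult_iff)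
  have "real (card {x. g x = 0}) * ?m \<le> C * dirichlet_walk E p \<nu> g"
    by (rule log_sobolev_test[OF C _ m]) auto
  also have "\<dots> \<le> C * (l * ?m)" using g(2) \<open>C \<ge> 0\<close> by (intro mult_left_mono) auto
  also have "\<dots> = C * l * ?m" by simp
  finally have "real (card {x. g x = 0}) \<le> C * l" using m by simp
  then show ?thesis using that g(1) by blast
qed

section \<open>Isolated vertices and one-point graphs\<close>

lemma Var_indicator_uniform:
  fixes x :: "'a::finite"
  shows "Var (pmf_of_set UNIV) (\<lambda>y. of_bool (y = x)) = 1 / CARD('a) - (1 / CARD('a))\<^sup>2"
proof -
  have "(of_bool P)\<^sup>2 = (of_bool P :: real)" for P by simp
  then show ?thesis
    unfolding Var_def expectation_finite by (simp add: of_bool_def sum.If_cases flip: sum_divide_distrib)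
qed

text \<open>The indicator of an isolated vertex has zero energy but positive variance. Symmetry of
  \<open>E\<close> excludes edges into the vertex as well as out of it.\<close>

lemma neighbour_exists_of_gap_pos:
  fixes E :: "('a::finite \<times> 'a) set"
  assumes "sym E" and nontriv: "CARD('a) > 1"
    and gap: "\<And>f. C * Var (pmf_of_set UNIV) f \<le> dirichlet_walk E p (pmf_of_set UNIV) f"
    and "C > 0"
  shows "\<exists>y. (x, y) \<in> E"
proof (rule ccontr)
  assume "\<nexists>y. (x, y) \<in> E"
  with \<open>sym E\<close> have iso: "u \<noteq> x" "v \<noteq> x" if "(u, v) \<in> E" for u v
    using that by (auto dest: symD)
  have "dirichlet_walk E p (pmf_of_set UNIV) (\<lambda>y. of_bool (y = x)) = 0"
    unfolding dirichlet_walk_def by (auto intro!: sum.neutral dest: iso)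
  then have "C * (1 / CARD('a) - (1 / CARD('a))\<^sup>2) \<le> 0"
    using gap[of "\<lambda>y. of_bool (y = x)"] unfolding Var_indicator_uniform by simp
  moreover have "1 / real CARD('a) - (1 / CARD('a))\<^sup>2 > 0"
    using nontriv by (simp add: field_simps power2_eq_square)
  ultimately show False using \<open>C > 0\<close> by (simp add: mult_le_0_iff)
qed

lemma Var_singleton_type:
  fixes \<rho> :: "'b::finite pmf"
  assumes "CARD('b) \<le> 1"
  shows "Var \<rho> f = 0"
proof -
  have "CARD('b) = 1" using assms by (simp add: le_Suc_eq)
  then obtain a where U: "(UNIV :: 'b set) = {a}" by (auto simp: card_1_singleton_iff)
  have "(\<Sum>x\<in>UNIV. pmf \<rho> x) = 1" by (rule sum_pmf_eq_1) auto
  then have "pmf \<rho> a = 1" by (simp add: U)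
  then show ?thesis unfolding Var_def expectation_finite U by simp
qed

section \<open>Combining the test functions with the expansion condition\<close>

theorem proposition2:
  fixes E :: "('a::finite \<times> 'a) set"
    and p :: "'a \<Rightarrow> 'a \<Rightarrow> real"
    and c :: "'a \<Rightarrow> 'a config \<Rightarrow> real"
    and \<mu> :: "'a config pmf" and \<nu> :: "'a pmf"
    and \<pi> :: "('a config \<times> 'a) pmf"
    and \<epsilon> :: real
  assumes "sym E"
    and "transition_probabilities E p" and "reversible_walk \<nu> p"
    and "\<And>x \<sigma>. c x \<sigma> \<ge> 0" and "reversible_lamps \<mu> c"
    and "\<pi> = pair_pmf \<mu> \<nu>"
    and "\<epsilon> > 0"
    and "\<And>B. real (card (nbhd E B)) \<ge> 1/2 * real CARD('a) \<Longrightarrow> real (card B) \<ge> \<epsilon> * real CARD('a)"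
    and "\<mu> = pmf_of_set UNIV" and "\<nu> = pmf_of_set UNIV"
  shows "log_sobolev_const E p c \<pi> \<ge> ereal \<epsilon> * (ereal (real CARD('a)) / spectral_gap E p \<nu>)"
proof -
  have p: "\<And>x y. p x y \<ge> 0" using assms(2) by (auto simp: transition_probabilities_def)
  define D where "D = dirichlet_walk E p \<nu>"
  have D0: "D f \<ge> 0" for f unfolding D_def by (rule dirichlet_walk_nonneg[OF p])
  have gap_ge: "ereal l \<le> spectral_gap E p \<nu>" if "\<And>f. l * Var \<nu> f \<le> D f" for l
    unfolding spectral_gap_def using that by (intro Sup_upper) (auto simp: D_def)
  have gap0: "spectral_gap E p \<nu> \<ge> 0"
    using gap_ge[of 0] D0 by (simp add: zero_ereal_def)
  have *: "ereal \<epsilon> * (ereal (real CARD('a)) / spectral_gap E p \<nu>) \<le> ereal C"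
    if C: "\<And>f. Ent \<pi> (\<lambda>z. (f z)\<^sup>2) \<le> C * dirichlet_lamplighter E p c \<pi> f" for C
  proof -
    note C' = C[unfolded assms(6,9)]
    have Cpos: "C \<ge> 0" by (rule log_sobolev_const_nonneg[OF C' p assms(4)])
    show ?thesis
    proof (cases "spectral_gap E p \<nu>")
      \<comment> \<open>Division by \<infinity> makes the left side 0, so the claim is just
        \<open>C \<ge> 0\<close>.\<close>
      case PInf
      then show ?thesis using Cpos by (simp add: zero_ereal_def[symmetric])
    next
      case MInf
      then show ?thesis using gap0 by simp
    next
      case (real r)
      then have r0: "r \<ge> 0" using gap0 by simp
      have half: "\<exists>B :: 'a set. CARD('a) \<le> 2 * card B \<and> real (card B) \<le> C * l" if "l > r" for l
      proof -
        have "\<not> (\<forall>f. l * Var \<nu> f \<le> D f)" using gap_ge[of l] real that by auto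
        then obtain f where "D f < l * Var \<nu> f" by (auto simp: not_le)
        moreover have "l > 0" using that r0 by simp
        ultimately show ?thesis
          using log_sobolev_times_gap_ge[OF C' Cpos p, of f l] unfolding D_def by metis
      qed
      have nontriv: "CARD('a) > 1"
      proof (rule ccontr)
        assume "\<not> CARD('a) > 1"
        \<comment> \<open>On one point the variance vanishes, so even \<open>r + 1\<close> is
          admissible, contradicting that the gap is \<open>r\<close>.\<close>
        then have "(r + 1) * Var \<nu> f \<le> D f" for f
          using D0 Var_singleton_type[of \<nu> f] by simp
        from gap_ge[OF this] real show False by simp
      qed
      show ?thesis
      proof (cases "r = 0")
        case True
        \<comment> \<open>For gap 0 the left side is \<infinity>, so no finite \<open>C\<close> may
          exist. This \<open>l\<close> makes \<open>C * l < 1\<close>, forcing \<open>B\<close> to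
          be empty although it holds at least half of the vertices; the summand 1 covers
          \<open>C = 0\<close>.\<close>
        define l where "l = 1 / (4 * (C + 1))"
        have "l > r" using Cpos True by (simp add: l_def)
        then obtain B :: "'a set" where B: "CARD('a) \<le> 2 * card B" "real (card B) \<le> C * l"
          using half by blast
        have "C * l < 1" using Cpos by (simp add: l_def field_simps)
        then have "real (card B) < 1" using B(2) by linarith
        then have "card B = 0" by linarith
        then show ?thesis using B(1) by simp
      next
        case False
        \<comment> \<open>The supremum need not be known to be attained: any admissible constant
          above \<open>r / 2\<close> is positive, which rules out isolated vertices.\<close>
        then have "ereal (r / 2) < spectral_gap E p \<nu>" using r0 real by simp
        then obtain C0 where C0: "r / 2 < C0" "\<And>f. C0 * Var \<nu> f \<le> D f"
          unfolding spectral_gap_def less_Sup_iff by (auto simp: D_def)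
        have "\<exists>y. (x, y) \<in> E" for x
          by (rule neighbour_exists_of_gap_pos[OF assms(1) nontriv, of C0 p])
             (use C0 r0 in \<open>auto simp: D_def assms(10)\<close>)
        then obtain h where h: "\<And>x. (x, h x) \<in> E" by metis
        have bound: "\<epsilon> * real CARD('a) \<le> C * l" if l: "l > r" for l
        proof -
          obtain B :: "'a set" where B: "CARD('a) \<le> 2 * card B" "real (card B) \<le> C * l"
            using half[OF l] by blast
          have "B \<subseteq> nbhd E (h ` B)" using h by (auto simp: nbhd_def)
          then have "card B \<le> card (nbhd E (h ` B))" by (intro card_mono) auto
          then have "\<epsilon> * real CARD('a) \<le> real (card (h ` B))"
            using B(1) by (intro assms(8)) auto
          also have "\<dots> \<le> real (card B)" by (simp add: card_image_le)
          finally show ?thesis using B(2) by simp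
        qed
        \<comment> \<open>Letting \<open>l\<close> decrease to \<open>r\<close>: the choice
          \<open>l = r + e / (C + 1)\<close> costs at most \<open>e\<close>, since
          \<open>C / (C + 1) \<le> 1\<close>.\<close>
        have "\<epsilon> * real CARD('a) \<le> C * r + e" if "e > 0" for e
        proof -
          have "C * (r + e / (C + 1)) \<le> C * r + e"
            using Cpos that by (simp add: field_simps)
          moreover have "r + e / (C + 1) > r" using Cpos that by simp
          ultimately show ?thesis
            using bound by (meson order_trans)
        qed
        then have "\<epsilon> * real CARD('a) \<le> C * r" by (rule field_le_epsilon)
        then have "\<epsilon> * (real CARD('a) / r) \<le> C"
          using False r0 by (simp add: field_simps)
        then show ?thesis using real False by simp
      qed
    qed
  qed
  show ?thesis
    unfolding log_sobolev_const_def by (rule Inf_greatest) (use * in auto)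
qed

end
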